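(* For every matroid on a ground set $E$ with $|E|\le 11$, the uniform probability measure on its independent sets (regarded as a measure on $\{0,1\}^E$ via indicator vectors) has the conditional antipodal pairs property (CAPP).
   Context: For $\nu$ a probability measure on $\{0,1\}^S$ with $|S|=m$, write $|\eta|=\sum\eta_i$, $\mathbf{1}=(1,\dots,1)$, and $\gamma_i(\nu)=\binom{m}{i}^{-1}\sum\{\nu(\eta)\nu(\mathbf{1}-\eta):\eta\in\{0,1\}^S,|\eta|=i\}$. If $|S|=2k$, $\nu$ has the antipodal pairs property (APP) if $\gamma_k(\nu)\ge\gamma_{k-1}(\nu)$. Conditioning a measure $\mu$ on $\{0,1\}^E$ means passing to $\mu(\cdot\mid\eta_i=\xi_i\ \forall i\in I)$ for some $I\subseteq E$, $\xi\in\{0,1\}^I$ with positive probability, regarded as a measure on $\{0,1\}^{E\setminus I}$. $\mu$ has the CAPP if every measure obtained from it by conditioning on the values of $|E|-2k$ coordinates (for some $k$) has the APP. *)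

theory Defs
  imports "HOL-Probability.Probability"
begin

locale matroid =
  fixes E :: "'a set" and \<I> :: "'a set set"
  assumes finite_ground: "finite E"
    and indep_subset_ground: "X \<in> \<I> \<Longrightarrow> X \<subseteq> E"
    and indep_empty: "{} \<in> \<I>"
    and indep_subset: "X \<in> \<I> \<Longrightarrow> Y \<subseteq> X \<Longrightarrow> Y \<in> \<I>"
    and indep_augment: "X \<in> \<I> \<Longrightarrow> Y \<in> \<I> \<Longrightarrow> card X < card Y \<Longrightarrow> \<exists>y\<in>Y - X. insert y X \<in> \<I>"

text \<open>
  An element of \<open>{0,1}\<^sup>S\<close> is a function on the ambient type that is \<^const>\<open>undefined\<close> outside
  \<open>S\<close>, so that there are exactly \<open>2 ^ card S\<close> of them. A probability measure on \<open>{0,1}\<^sup>S\<close>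
  is a \<open>pmf\<close> on functions whose support is contained in \<open>cube S\<close>.
\<close>

definition cube :: "'a set \<Rightarrow> ('a \<Rightarrow> nat) set" where
  "cube S = S \<rightarrow>\<^sub>E {0, 1}"

definition antipodal_avg :: "'a set \<Rightarrow> ('a \<Rightarrow> nat) pmf \<Rightarrow> nat \<Rightarrow> real" where
  "antipodal_avg S \<nu> i =
     inverse (real (card S choose i)) *
     (\<Sum>\<eta> | \<eta> \<in> cube S \<and> (\<Sum>j\<in>S. \<eta> j) = i. pmf \<nu> \<eta> * pmf \<nu> (\<lambda>j\<in>S. 1 - \<eta> j))"

text \<open>
  For \<open>S\<close> empty the index \<open>k - 1\<close> would be negative, so the property is only considered for
  \<open>k \<ge> 1\<close>.
\<close>

definition APP :: "'a set \<Rightarrow> ('a \<Rightarrow> nat) pmf \<Rightarrow> bool" where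
  "APP S \<nu> \<longleftrightarrow>
     (\<exists>k\<ge>1. card S = 2 * k \<and> antipodal_avg S \<nu> k \<ge> antipodal_avg S \<nu> (k - 1))"

definition agree_on :: "'a set \<Rightarrow> ('a \<Rightarrow> nat) \<Rightarrow> ('a \<Rightarrow> nat) set" where
  "agree_on I \<xi> = {\<eta>. \<forall>i\<in>I. \<eta> i = \<xi> i}"

text \<open>\<^const>\<open>cond_pmf\<close> is meaningful only if the conditioning event has positive probability.\<close>

definition conditioned ::
  "'a set \<Rightarrow> 'a set \<Rightarrow> ('a \<Rightarrow> nat) \<Rightarrow> ('a \<Rightarrow> nat) pmf \<Rightarrow> ('a \<Rightarrow> nat) pmf" where
  "conditioned E I \<xi> \<mu> = map_pmf (\<lambda>\<eta>. restrict \<eta> (E - I)) (cond_pmf \<mu> (agree_on I \<xi>))"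

definition CAPP :: "'a set \<Rightarrow> ('a \<Rightarrow> nat) pmf \<Rightarrow> bool" where
  "CAPP E \<mu> \<longleftrightarrow>
     (\<forall>k\<ge>1. \<forall>I \<xi>. I \<subseteq> E \<and> card I + 2 * k = card E \<and> \<xi> \<in> cube I \<and>
        measure_pmf.prob \<mu> (agree_on I \<xi>) > 0 \<longrightarrow> APP (E - I) (conditioned E I \<xi> \<mu>))"

definition indicator_vec :: "'a set \<Rightarrow> 'a set \<Rightarrow> 'a \<Rightarrow> nat" where
  "indicator_vec E X = (\<lambda>i\<in>E. of_bool (i \<in> X))"

definition uniform_indep :: "'a set \<Rightarrow> 'a set set \<Rightarrow> ('a \<Rightarrow> nat) pmf" where
  "uniform_indep E \<I> = map_pmf (indicator_vec E) (pmf_of_set \<I>)"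

lemma set_pmf_conditioned_subset_cube:
  assumes "set_pmf \<mu> \<subseteq> cube E" "I \<subseteq> E" "measure_pmf.prob \<mu> (agree_on I \<xi>) > 0"
  shows "set_pmf (conditioned E I \<xi> \<mu>) \<subseteq> cube (E - I)"
proof -
  have "set_pmf \<mu> \<inter> agree_on I \<xi> \<noteq> {}"
    using assms(3) by (metis Int_commute less_irrefl measure_Int_set_pmf measure_empty)
  then have "set_pmf (cond_pmf \<mu> (agree_on I \<xi>)) \<subseteq> cube E"
    using assms(1) by (auto simp: set_cond_pmf)
  then show ?thesis
    by (fastforce simp: conditioned_def cube_def PiE_iff)
qed

lemma set_pmf_uniform_indep_subset_cube: "set_pmf (uniform_indep E \<I>) \<subseteq> cube E"
  by (auto simp: uniform_indep_def indicator_vec_def cube_def)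

lemma (in matroid) pmf_uniform_indep:
  assumes "X \<in> \<I>"
  shows "pmf (uniform_indep E \<I>) (indicator_vec E X) = 1 / card \<I>"
proof -
  have fin: "finite \<I>"
    using finite_ground indep_subset_ground by (meson PowI finite_Pow_iff finite_subset subsetI)
  have inj: "inj_on (indicator_vec E) \<I>"
  proof (rule inj_onI)
    fix A B assume AB: "A \<in> \<I>" "B \<in> \<I>" and eq: "indicator_vec E A = indicator_vec E B"
    have "i \<in> A \<longleftrightarrow> i \<in> B" if "i \<in> E" for i
      using fun_cong[OF eq, of i] that by (simp add: indicator_vec_def of_bool_eq_iff)
    then show "A = B"
      using AB indep_subset_ground by blast
  qed
  have ne: "\<I> \<noteq> {}"
    using indep_empty by blast
  have "uniform_indep E \<I> = pmf_of_set (indicator_vec E ` \<I>)"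
    unfolding uniform_indep_def using map_pmf_of_set_inj[OF inj ne fin] .
  then show ?thesis
    using assms ne fin by (simp add: pmf_of_set card_image[OF inj])
qed

end

theory Submission
  imports Defs
begin

text \<open>
  Conditioning yields the uniform measure on a minor, so it suffices to treat a matroid on \<open>2k\<close>
  elements with \<open>k \<le> 5\<close>. Let \<open>\<Omega>\<^sub>i\<close> be the family of \<open>i\<close>-sets \<open>X\<close> such that \<open>X\<close> and its complement are both
  independent; the claim is \<open>(k + 1) |\<Omega>\<^sub>k\<^sub>-\<^sub>1| \<le> k |\<Omega>\<^sub>k|\<close>. Every \<open>X \<in> \<Omega>\<^sub>k\<^sub>-\<^sub>1\<close> spreads a unit charge
  evenly over its one-element independent extensions, which all lie in \<open>\<Omega>\<^sub>k\<close>. Since \<open>\<Omega>\<^sub>k\<close> is closed under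
  complements, it is enough that complementary \<open>C, D \<in> \<Omega>\<^sub>k\<close> together receive at most
  \<open>2k / (k + 1)\<close>. Let \<open>C'\<close> be the set of those \<open>c \<in> C\<close> outside the span of \<open>D\<close>, define \<open>D'\<close>
  symmetrically, and put \<open>s = |C'| \<ge> t = |D'|\<close>. The charge through \<open>c \<in> C'\<close> is the inverse of
  one plus the number of \<open>d \<in> D\<close> for which \<open>C - c + d\<close> is independent. All \<open>d \<in> D'\<close> count here,
  and each \<open>d \<in> D - D'\<close> counts for every \<open>c\<close> in its fundamental circuit in \<open>C + d\<close>. That circuit
  cannot meet \<open>C'\<close> in exactly one element, and at most \<open>k - s\<close> of the \<open>d\<close> have circuits avoiding \<open>C'\<close>, which
  gives at least \<open>2 (s - t)\<close> incidences in excess of those from \<open>D'\<close>. By convexity of \<open>1/x\<close> the bound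
  reduces to an inequality in \<open>k, s, t\<close> that is valid for \<open>k \<le> 5\<close>.
\<close>

section \<open>Conditioning a uniform distribution\<close>

lemma cond_pmf_of_set:
  assumes "finite A" "A \<inter> B \<noteq> {}"
  shows "cond_pmf (pmf_of_set A) B = pmf_of_set (A \<inter> B)"
proof (rule pmf_eqI)
  fix x
  have A: "A \<noteq> {}" using assms by auto
  then have "set_pmf (pmf_of_set A) \<inter> B \<noteq> {}" using assms by simp
  moreover have "card A > 0" "card (A \<inter> B) > 0" using assms A by (auto simp: card_gt_0_iff)
  ultimately show "pmf (cond_pmf (pmf_of_set A) B) x = pmf (pmf_of_set (A \<inter> B)) x"
    using assms A by (auto simp: pmf_cond measure_pmf_of_set indicator_def)
qed

section \<open>Augmentation and span\<close>

context matroid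
begin

lemma indep_finite: "X \<in> \<I> \<Longrightarrow> finite X"
  using finite_ground indep_subset_ground finite_subset by blast

lemma indep_extend:
  assumes "X \<in> \<I>" "Y \<in> \<I>" "card X \<le> card Y"
  shows "\<exists>Z\<in>\<I>. X \<subseteq> Z \<and> Z \<subseteq> X \<union> Y \<and> card Z = card Y"
  using assms
proof (induction "card Y - card X" arbitrary: X)
  case 0
  then show ?case by (intro bexI[of _ X]) auto
next
  case (Suc n)
  then obtain y where y: "y \<in> Y - X" "insert y X \<in> \<I>"
    using indep_augment[of X Y] by fastforce
  have card: "card (insert y X) = Suc (card X)"
    using y Suc.prems(1) by (simp add: indep_finite)
  have "n = card Y - card (insert y X)" "card (insert y X) \<le> card Y"
    using card Suc.hyps(2) by auto
  then obtain Z where "Z \<in> \<I>" "insert y X \<subseteq> Z" "Z \<subseteq> insert y X \<union> Y" "card Z = card Y"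
    using Suc.hyps(1)[of "insert y X"] y Suc.prems by blast
  then show ?case using y by (intro bexI[of _ Z]) auto
qed

text \<open>For independent \<open>D\<close> this is the matroid closure, enlarged by all elements
  outside \<open>E\<close>, since no independent set contains those.\<close>

definition span :: "'a set \<Rightarrow> 'a set" where
  "span D = D \<union> {x. insert x D \<notin> \<I>}"

text \<open>A larger \<open>A\<close> would augment \<open>D\<close> by an element that
  \<open>span D\<close> excludes.\<close>

lemma card_le_of_subset_span:
  assumes "D \<in> \<I>" "A \<in> \<I>" "A \<subseteq> span D"
  shows "card A \<le> card D"
  using assms indep_augment[of D A] by (fastforce simp: span_def)

text \<open>Enlarge \<open>A\<close> inside \<open>A \<union> D\<close> to an independent
  \<open>B\<close> of size \<open>card D\<close>. The larger set \<open>insert c D\<close> augments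
  \<open>B\<close>, and only \<open>c\<close> can be the new element: any other would give an
  independent subset of \<open>span D\<close> with more than \<open>card D\<close> elements.\<close>

lemma insert_indep_of_subset_span:
  assumes D: "D \<in> \<I>" and A: "A \<in> \<I>" "A \<subseteq> span D" and c: "c \<notin> span D"
  shows "insert c A \<in> \<I>"
proof -
  have cD: "c \<notin> D" "insert c D \<in> \<I>" using c by (auto simp: span_def)
  obtain B where B: "B \<in> \<I>" "A \<subseteq> B" "B \<subseteq> A \<union> D" "card B = card D"
    using indep_extend[OF A(1) D card_le_of_subset_span[OF D A]] by blast
  have "card B < card (insert c D)" using cD B D by (simp add: indep_finite)
  then obtain y where y: "y \<in> insert c D - B" "insert y B \<in> \<I>"
    using indep_augment[OF B(1) cD(2)] by blast
  have "y = c"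
  proof (rule ccontr)
    assume "y \<noteq> c"
    then have "insert y B \<subseteq> span D" using y B A by (auto simp: span_def)
    then have "card (insert y B) \<le> card D" using card_le_of_subset_span D y by blast
    then show False using y B by (simp add: indep_finite)
  qed
  then show ?thesis using y B indep_subset[of "insert c B" "insert c A"] by blast
qed

section \<open>Fundamental circuits\<close>

text \<open>If \<open>insert d C\<close> is dependent, the set below together with \<open>d\<close> is its fundamental circuit.\<close>

definition exch :: "'a set \<Rightarrow> 'a \<Rightarrow> 'a set" where
  "exch C d = {c \<in> C. insert d (C - {c}) \<in> \<I>}"

text \<open>Otherwise the set extends within \<open>insert d C\<close> to an independent
  \<open>Z\<close> of size \<open>card C\<close>. Then \<open>Z\<close> is \<open>C\<close> with
  some \<open>x\<close> exchanged for \<open>d\<close>, so \<open>x\<close> lies in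
  \<open>exch C d\<close> and hence in \<open>Z\<close>, a contradiction.\<close>

lemma insert_exch_dependent:
  assumes C: "C \<in> \<I>" and d: "d \<notin> C" "insert d C \<notin> \<I>"
  shows "insert d (exch C d) \<notin> \<I>"
proof
  let ?K = "insert d (exch C d)"
  assume K: "?K \<in> \<I>"
  have fin: "finite C" using C indep_finite by blast
  have "exch C d \<noteq> C" using K d by metis
  then have sub: "exch C d \<subset> C" by (auto simp: exch_def)
  then have "card (exch C d) < card C" using fin psubset_card_mono by blast
  then have "card ?K \<le> card C"
    using sub fin d by (metis Suc_leI card_insert_disjoint finite_subset psubset_eq subsetD)
  then obtain Z where Z: "Z \<in> \<I>" "?K \<subseteq> Z" "Z \<subseteq> ?K \<union> C" "card Z = card C"
    using indep_extend[OF K C] by blast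
  have dZ: "d \<in> Z" using Z(2) by blast
  have "\<not> C \<subseteq> Z" using indep_subset[OF Z(1), of "insert d C"] d dZ by blast
  then obtain x where x: "x \<in> C" "x \<notin> Z" by blast
  have "Z \<subseteq> insert d (C - {x})" using Z x sub by auto
  moreover have "card (insert d (C - {x})) = card C"
    using fin d x by (metis Diff_iff card_Suc_Diff1 card_insert_disjoint finite_Diff)
  ultimately have "Z = insert d (C - {x})"
    using Z fin by (metis card_subset_eq finite_Diff finite_insert)
  then have "x \<in> exch C d" using x Z by (auto simp: exch_def)
  then show False using x Z by auto
qed

section \<open>Extensions and exchanges between disjoint independent sets\<close>

definition ext :: "'a set \<Rightarrow> 'a set \<Rightarrow> 'a set" where
  "ext C D = {c \<in> C. insert c D \<in> \<I>}"

text \<open>For \<open>D = E - C\<close>, \<open>ext C D\<close> is the set C' of the overview, and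
  \<open>nbrs C D c\<close> collects the one-element independent extensions of
  \<open>C - {c}\<close> other than \<open>c\<close> itself; hence the summand 1 in the denominators
  of \<open>load\<close>.\<close>

definition nbrs :: "'a set \<Rightarrow> 'a set \<Rightarrow> 'a \<Rightarrow> 'a set" where
  "nbrs C D c = {d \<in> D. insert d (C - {c}) \<in> \<I>}"

text \<open>The charge received by \<open>C\<close> when \<open>D\<close> is its complement.\<close>

definition load :: "'a set \<Rightarrow> 'a set \<Rightarrow> real" where
  "load C D = (\<Sum>c\<in>ext C D. 1 / (1 + real (card (nbrs C D c))))"

lemma ext_subset_nbrs: "ext D C \<subseteq> nbrs C D c"
proof
  fix d assume "d \<in> ext D C"
  then have "d \<in> D" "insert d C \<in> \<I>" by (auto simp: ext_def)
  moreover from this(2) have "insert d (C - {c}) \<in> \<I>" by (rule indep_subset) blast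
  ultimately show "d \<in> nbrs C D c" by (simp add: nbrs_def)
qed

text \<open>If \<open>c\<close> were the only common element, the rest of the circuit would be
  independent and inside \<open>span D\<close>. As \<open>c\<close> is outside that span, putting it
  back would keep independence, but the circuit is dependent.\<close>

lemma card_exch_ext_neq_1:
  assumes C: "C \<in> \<I>" and D: "D \<in> \<I>" and disj: "C \<inter> D = {}" and d: "d \<in> D - ext D C"
  shows "card (exch C d \<inter> ext C D) \<noteq> 1"
proof
  assume "card (exch C d \<inter> ext C D) = 1"
  then obtain c where c: "exch C d \<inter> ext C D = {c}" using card_1_singletonE by blast
  let ?A = "insert d (exch C d - {c})"
  have "?A \<subseteq> insert d (C - {c})" "insert d (C - {c}) \<in> \<I>"
    using c by (auto simp: exch_def)
  then have "?A \<in> \<I>" by (rule indep_subset[rotated])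
  moreover have "?A \<subseteq> span D"
    using c d by (auto simp: span_def exch_def ext_def)
  moreover have "c \<notin> span D" using c disj by (auto simp: span_def ext_def)
  ultimately have "insert c ?A \<in> \<I>" using insert_indep_of_subset_span[OF D] by blast
  moreover have "insert c ?A = insert d (exch C d)" using c by auto
  moreover have "insert d (exch C d) \<notin> \<I>"
    using insert_exch_dependent[OF C, of d] d disj by (auto simp: ext_def)
  ultimately show False by simp
qed

text \<open>A circuit that avoids \<open>ext C D\<close> shows that its \<open>d\<close> is spanned
  by \<open>C - ext C D\<close>, so these \<open>d\<close> form an independent set inside that
  span.\<close>

lemma card_unlinked_le:
  assumes C: "C \<in> \<I>" and D: "D \<in> \<I>" and disj: "C \<inter> D = {}"
  shows "card {d \<in> D - ext D C. exch C d \<inter> ext C D = {}} \<le> card (C - ext C D)"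
    (is "card ?Z \<le> _")
proof (rule card_le_of_subset_span)
  show "C - ext C D \<in> \<I>" "?Z \<in> \<I>"
    by (rule indep_subset[OF C], blast, rule indep_subset[OF D], blast)
  show "?Z \<subseteq> span (C - ext C D)"
  proof
    fix d assume d: "d \<in> ?Z"
    then have "insert d (exch C d) \<notin> \<I>"
      using insert_exch_dependent[OF C, of d] disj by (auto simp: ext_def)
    moreover have "exch C d \<subseteq> C - ext C D" using d by (auto simp: exch_def)
    ultimately have "insert d (C - ext C D) \<notin> \<I>"
      using indep_subset[of "insert d (C - ext C D)" "insert d (exch C d)"] by blast
    then show "d \<in> span (C - ext C D)" by (simp add: span_def)
  qed
qed

text \<open>Incidences are counted from the side of \<open>D\<close>. Each \<open>d\<close> in
  \<open>?D0 - ?Z\<close> has at least two, and with \<open>k\<close>, \<open>s\<close>,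
  \<open>t\<close> as in the overview there are at least \<open>(k - t) - (k - s) = s - t\<close>
  such \<open>d\<close>. The term in \<open>t\<close> stands on the left to avoid truncated
  subtraction.\<close>

lemma sum_card_nbrs_ge:
  assumes C: "C \<in> \<I>" and D: "D \<in> \<I>" and disj: "C \<inter> D = {}" and card: "card C = card D"
  shows "(\<Sum>c\<in>ext C D. card (nbrs C D c - ext D C)) + 2 * card (ext D C) \<ge> 2 * card (ext C D)"
proof -
  let ?D0 = "D - ext D C"
  let ?Z = "{d \<in> ?D0. exch C d \<inter> ext C D = {}}"
  have fin: "finite C" "finite D" using C D indep_finite by auto
  have sub: "ext C D \<subseteq> C" "ext D C \<subseteq> D" by (auto simp: ext_def)
  have fin': "finite (ext C D)" "finite (ext D C)" using fin sub finite_subset by blast+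
  have "(\<Sum>c\<in>ext C D. card (nbrs C D c - ext D C))
      = (\<Sum>c\<in>ext C D. \<Sum>d\<in>?D0. if insert d (C - {c}) \<in> \<I> then 1 else 0)"
  proof (rule sum.cong[OF refl])
    fix c
    have "nbrs C D c - ext D C = {d \<in> ?D0. insert d (C - {c}) \<in> \<I>}"
      by (auto simp: nbrs_def)
    then show "card (nbrs C D c - ext D C)
        = (\<Sum>d\<in>?D0. if insert d (C - {c}) \<in> \<I> then 1 else 0)"
      using fin by (simp add: sum.If_cases Int_def)
  qed
  also have "\<dots> = (\<Sum>d\<in>?D0. \<Sum>c\<in>ext C D. if insert d (C - {c}) \<in> \<I> then 1 else 0)"
    by (rule sum.swap)
  also have "\<dots> = (\<Sum>d\<in>?D0. card (exch C d \<inter> ext C D))"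
  proof (rule sum.cong[OF refl])
    fix d
    have "exch C d \<inter> ext C D = {c \<in> ext C D. insert d (C - {c}) \<in> \<I>}"
      by (auto simp: exch_def ext_def)
    then show "(\<Sum>c\<in>ext C D. if insert d (C - {c}) \<in> \<I> then 1 else 0)
        = card (exch C d \<inter> ext C D)"
      using fin' by (simp add: sum.If_cases Int_def)
  qed
  also have "\<dots> \<ge> (\<Sum>d\<in>?D0 - ?Z. 2)"
  proof -
    have "(\<Sum>d\<in>?D0 - ?Z. 2) \<le> (\<Sum>d\<in>?D0 - ?Z. card (exch C d \<inter> ext C D))"
    proof (rule sum_mono)
      fix d assume d: "d \<in> ?D0 - ?Z"
      then have "card (exch C d \<inter> ext C D) \<noteq> 1"
        using card_exch_ext_neq_1[OF C D disj] by blast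
      moreover have "card (exch C d \<inter> ext C D) \<noteq> 0" using d fin' by auto
      ultimately show "2 \<le> card (exch C d \<inter> ext C D)" by linarith
    qed
    also have "\<dots> \<le> (\<Sum>d\<in>?D0. card (exch C d \<inter> ext C D))"
      using fin by (intro sum_mono2) auto
    finally show ?thesis .
  qed
  finally have "(\<Sum>c\<in>ext C D. card (nbrs C D c - ext D C)) \<ge> 2 * card (?D0 - ?Z)" by simp
  moreover have "card (?D0 - ?Z) = card ?D0 - card ?Z"
    using fin by (intro card_Diff_subset) auto
  moreover have "card ?D0 = card D - card (ext D C)" "card (C - ext C D) = card C - card (ext C D)"
    using fin' sub by (auto intro: card_Diff_subset)
  moreover have "card (ext C D) \<le> card C" "card (ext D C) \<le> card D"
    using fin sub by (auto intro: card_mono)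
  ultimately show ?thesis using card_unlinked_le[OF C D disj] card by linarith
qed

text \<open>\<open>insert c D\<close> is larger than \<open>C\<close> and so augments it; the new
  element is not \<open>c\<close>, which already lies in \<open>C\<close>.\<close>

lemma ext_nonempty:
  assumes "C \<in> \<I>" "D \<in> \<I>" "C \<inter> D = {}" "card C = card D" "ext C D \<noteq> {}"
  shows "ext D C \<noteq> {}"
proof -
  obtain c where c: "c \<in> C" "insert c D \<in> \<I>" using assms by (auto simp: ext_def)
  then have "card C < card (insert c D)" using assms
    by (simp add: disjoint_iff indep_finite)
  then show ?thesis using indep_augment[OF assms(1) c(2)] c by (auto simp: ext_def)
qed

text \<open>Otherwise \<open>C - {c}\<close> spans all of \<open>?D0\<close>. It also contains a
  second element \<open>c2\<close> of \<open>ext C D\<close>, so it would span the independent set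
  \<open>insert c2 ?D0\<close>, which is larger by one.\<close>

lemma nbrs_not_subset_ext:
  assumes C: "C \<in> \<I>" and D: "D \<in> \<I>" and disj: "C \<inter> D = {}" and card: "card C = card D"
    and t: "card (ext D C) = 1" and s: "2 \<le> card (ext C D)" and c: "c \<in> ext C D"
  shows "nbrs C D c - ext D C \<noteq> {}"
proof
  assume none: "nbrs C D c - ext D C = {}"
  let ?D0 = "D - ext D C"
  have fin: "finite C" "finite D" using C D indep_finite by auto
  have "\<not> ext C D \<subseteq> {c}" using s card_mono[of "{c}" "ext C D"] by auto
  then obtain c2 where c2: "c2 \<in> ext C D" "c2 \<noteq> c" by blast
  have c2C: "c2 \<in> C" "c2 \<notin> ?D0" "c \<in> C" using c2 c disj by (auto simp: ext_def)
  have "ext D C \<subseteq> D" by (auto simp: ext_def)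
  then have "card ?D0 = card C - 1"
    using t card fin by (simp add: card_Diff_subset finite_subset)
  moreover have "card C > 0" using fin c2C by (auto simp: card_gt_0_iff)
  ultimately have big: "card (C - {c}) < card (insert c2 ?D0)" using c2C fin by simp
  have C1: "C - {c} \<in> \<I>" by (rule indep_subset[OF C]) blast
  have "insert c2 D \<in> \<I>" using c2 by (simp add: ext_def)
  then have "insert c2 ?D0 \<in> \<I>" by (rule indep_subset) blast
  then have "card (insert c2 ?D0) \<le> card (C - {c})"
  proof (rule card_le_of_subset_span[OF C1])
    show "insert c2 ?D0 \<subseteq> span (C - {c})"
      using none c2C c2 by (auto simp: span_def nbrs_def)
  qed
  then show False using big by simp
qed

end

section \<open>Numerical inequalities\<close>

lemma chord:
  fixes x a b :: real
  assumes "0 < a" "a \<le> x" "x \<le> b"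
  shows "1 / x \<le> (a + b - x) / (a * b)"
proof -
  \<comment> \<open>The bound is the chord of the convex function \<open>1 / x\<close> over
    \<open>[a, b]\<close>; clearing denominators leaves this product.\<close>
  have "0 \<le> (x - a) * (b - x)" using assms by simp
  then show ?thesis using assms by (simp add: field_simps)
qed

text \<open>The two summands on the left bound \<open>load C D\<close> and \<open>load D C\<close>.
  There is equality at \<open>k = s = 5\<close>, \<open>t = 2\<close>, and the inequality fails at
  \<open>k = s = 6\<close>, \<open>t = 2\<close>.\<close>

lemma load_arith:
  fixes k s t :: nat
  assumes "k \<le> 5" "2 \<le> t" "t \<le> s" "s \<le> k"
  shows "(real s * (k + 1) - 2 * (real s - t)) / ((t + 1) * (k + 1)) + t / (s + 1) \<le> 2 * k / (k + 1)"
proof -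
  have "k \<in> {2,3,4,5}" "t \<in> {2,3,4,5}" "s \<in> {2,3,4,5}" using assms by auto
  then show ?thesis using assms by auto
qed

text \<open>The case \<open>t = 1\<close>. The left side of \<open>load_arith\<close> would be too
  large here, for instance at \<open>k = s = 5\<close>, so the chord starts at 3 instead of
  \<open>t + 1 = 2\<close>.\<close>

lemma load_arith_1:
  fixes k s :: nat
  assumes "k \<le> 5" "2 \<le> s" "s \<le> k"
  shows "(real s * k + 2) / (3 * (k + 1)) + 1 / (s + 1) \<le> 2 * k / (k + 1)"
proof -
  have "k \<in> {2,3,4,5}" "s \<in> {2,3,4,5}" using assms by auto
  then show ?thesis using assms by auto
qed

section \<open>The load of a complementary pair\<close>

context matroid
begin

lemma load_sum_le_aux:
  assumes C: "C \<in> \<I>" and D: "D \<in> \<I>" and disj: "C \<inter> D = {}"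
    and cC: "card C = k" and cD: "card D = k" and k: "k \<le> 5"
    and le: "card (ext D C) \<le> card (ext C D)"
  shows "load C D + load D C \<le> 2 * real k / (real k + 1)"
proof -
  define s t where "s = card (ext C D)" and "t = card (ext D C)"
  define deg0 where "deg0 c = card (nbrs C D c - ext D C)" for c
  have fin: "finite C" "finite D" using C D indep_finite by auto
  have sub: "ext C D \<subseteq> C" "ext D C \<subseteq> D" by (auto simp: ext_def)
  have fin': "finite (ext C D)" "finite (ext D C)" using fin sub finite_subset by blast+
  have sk: "s \<le> k" using fin sub cC by (auto simp: s_def intro: card_mono)
  have ts: "t \<le> s" using le by (simp add: s_def t_def)
  have nsub: "nbrs C D c \<subseteq> D" "nbrs D C c \<subseteq> C" for c by (auto simp: nbrs_def)
  have deg: "card (nbrs C D c) = t + deg0 c" for c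
  proof -
    have f: "finite (nbrs C D c)" using nsub fin finite_subset by blast
    then have "deg0 c = card (nbrs C D c) - t" "t \<le> card (nbrs C D c)"
      using ext_subset_nbrs[of D C c] fin'
      by (auto simp: deg0_def t_def intro: card_Diff_subset card_mono)
    then show ?thesis by simp
  qed
  have degk: "t + deg0 c \<le> k" for c
    using deg[of c] card_mono[OF fin(2) nsub(1)] cD by metis
  have sumdeg: "real (\<Sum>c\<in>ext C D. deg0 c) \<ge> 2 * (real s - real t)"
  proof -
    have "2 * s \<le> (\<Sum>c\<in>ext C D. deg0 c) + 2 * t"
      using sum_card_nbrs_ge[OF C D disj] cC cD by (simp add: deg0_def s_def t_def)
    then have "real (2 * s) \<le> real ((\<Sum>c\<in>ext C D. deg0 c) + 2 * t)"
      by (simp only: of_nat_le_iff)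
    then show ?thesis by simp
  qed
  have loadC: "load C D = (\<Sum>c\<in>ext C D. 1 / (1 + real t + real (deg0 c)))"
    by (simp add: load_def deg add.assoc)
  \<comment> \<open>Every \<open>d\<close> in \<open>ext D C\<close> has all of
    \<open>ext C D\<close> among its neighbours, so each denominator is at least
    \<open>s + 1\<close>.\<close>
  have loadD: "load D C \<le> t / (s + 1)"
  proof -
    have "load D C \<le> (\<Sum>d\<in>ext D C. 1 / (real s + 1))"
      unfolding load_def
    proof (rule sum_mono)
      fix d
      have "s \<le> card (nbrs D C d)"
        unfolding s_def using ext_subset_nbrs nsub fin
        by (meson card_mono finite_subset)
      then show "1 / (1 + real (card (nbrs D C d))) \<le> 1 / (real s + 1)"
        by (intro divide_left_mono) auto
    qed
    also have "\<dots> = t / (s + 1)" by (simp add: t_def)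
    finally show ?thesis .
  qed
  \<comment> \<open>The chord is taken over \<open>[m, k + 1]\<close>: the right end is valid
    because an element has at most \<open>k\<close> neighbours, and \<open>m\<close> is left open to
    suit the cases below. The chord being linear, only the total of \<open>deg0\<close> matters,
    which \<open>sumdeg\<close> bounds.\<close>
  have chord_sum: "load C D \<le> (s * (m + real k) - (1 + real t) * s - 2 * (real s - t) + s) / (m * (k + 1))"
    if m: "m > 0" "\<And>c. c \<in> ext C D \<Longrightarrow> m \<le> 1 + real t + real (deg0 c)" for m :: real
  proof -
    have "load C D \<le> (\<Sum>c\<in>ext C D. (m + (k + 1) - (1 + real t + real (deg0 c))) / (m * (k + 1)))"
      unfolding loadC
    proof (rule sum_mono)
      fix c assume c: "c \<in> ext C D"
      have "real t + real (deg0 c) \<le> real k" using degk[of c] by linarith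
      then show "1 / (1 + real t + real (deg0 c))
          \<le> (m + (k + 1) - (1 + real t + real (deg0 c))) / (m * (k + 1))"
        using chord[OF m(1) m(2)[OF c], of "real k + 1"] by (simp add: add_ac)
    qed
    also have "\<dots> = (\<Sum>c\<in>ext C D. m + (k + 1) - (1 + real t + real (deg0 c))) / (m * (k + 1))"
      by (simp add: sum_divide_distrib)
    also have "(\<Sum>c\<in>ext C D. m + (k + 1) - (1 + real t + real (deg0 c)))
        = s * (m + k + 1) - (1 + real t) * s - real (\<Sum>c\<in>ext C D. deg0 c)"
      by (simp add: sum.distrib sum_subtractf s_def[symmetric] algebra_simps)
    also have "\<dots> / (m * (k + 1))
        \<le> (s * (m + real k) - (1 + real t) * s - 2 * (real s - t) + s) / (m * (k + 1))"
      using sumdeg m(1) by (intro divide_right_mono) (auto simp: algebra_simps)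
    finally show ?thesis .
  qed
  \<comment> \<open>\<open>ext_nonempty\<close> excludes \<open>t = 0 < s\<close>. The pair
    \<open>s = t = 1\<close> is separate because \<open>nbrs_not_subset_ext\<close> requires
    \<open>s \<ge> 2\<close>.\<close>
  consider "s = 0" | "s = 1" "t = 1" | "t = 1" "s \<ge> 2" | "t \<ge> 2"
  proof -
    have "s \<noteq> 0 \<Longrightarrow> t \<noteq> 0"
      using ext_nonempty[OF C D disj] cC cD fin' by (auto simp: s_def t_def)
    then show ?thesis using that ts by linarith
  qed
  then show ?thesis
  proof cases
    case 1
    then show ?thesis using ts fin' by (simp add: s_def t_def load_def)
  next
    case 2
    have "load C D \<le> (\<Sum>c\<in>ext C D. 1 / 2)"
      unfolding loadC using 2 by (intro sum_mono) (auto intro!: divide_left_mono)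
    then have "load C D + load D C \<le> 1" using 2 loadD by (simp add: s_def)
    also have "\<dots> \<le> 2 * real k / (real k + 1)" using sk 2 by (simp add: field_simps)
    finally show ?thesis .
  next
    case 3
    have "3 \<le> 1 + real t + real (deg0 c)" if "c \<in> ext C D" for c
    proof -
      have "finite (nbrs C D c)" using nsub fin finite_subset by blast
      then have "deg0 c \<noteq> 0"
        using nbrs_not_subset_ext[OF C D disj _ _ _ that] 3 cC cD
        by (auto simp: deg0_def s_def t_def)
      then show ?thesis using 3 by simp
    qed
    from chord_sum[OF _ this]
    have "load C D \<le> (real s * k + 2) / (3 * (k + 1))"
      using 3 by (simp add: algebra_simps)
    then show ?thesis using load_arith_1[OF k 3(2) sk] loadD 3 by (simp add: add_ac)
  next
    case 4
    have "load C D \<le> (real s * (k + 1) - 2 * (real s - t)) / ((t + 1) * (k + 1))"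
      using chord_sum[of "real t + 1"] by (simp add: algebra_simps)
    then show ?thesis using load_arith[OF k 4 ts sk] loadD by (simp add: add_ac)
  qed
qed

lemma load_sum_le:
  assumes "C \<in> \<I>" "D \<in> \<I>" "C \<inter> D = {}" "card C = k" "card D = k" "k \<le> 5"
  shows "load C D + load D C \<le> 2 * real k / (real k + 1)"
  using load_sum_le_aux[OF assms(1-6)] load_sum_le_aux[of D C k] assms
  by (cases "card (ext D C) \<le> card (ext C D)") (auto simp: Int_commute add.commute)

section \<open>Counting the families \<Omega>_i of the overview (\<open>split_sets\<close>)\<close>

definition split_sets :: "nat \<Rightarrow> 'a set set" where
  "split_sets i = {X. X \<subseteq> E \<and> card X = i \<and> X \<in> \<I> \<and> E - X \<in> \<I>}"

lemma finite_split_sets: "finite (split_sets i)"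
  using finite_ground by (auto simp: split_sets_def intro: finite_subset[of _ "Pow E"])

text \<open>Each \<open>X\<close> spreads its unit charge over the pairs \<open>(X, y)\<close> with
  \<open>y\<close> in \<open>U X\<close>; the bijection
  \<open>(X, y) \<mapsto> (insert y X, y)\<close> regroups these charges by their receivers.\<close>

lemma card_split_sets_eq_load:
  assumes cE: "card E = 2 * k" and k: "1 \<le> k"
  shows "real (card (split_sets (k - 1))) = (\<Sum>C\<in>split_sets k. load C (E - C))"
proof -
  define U where "U X = {y \<in> E - X. insert y X \<in> \<I>}" for X
  have finU: "finite (U X)" for X using finite_ground by (simp add: U_def)
  have "real (card (split_sets (k - 1))) = (\<Sum>X\<in>split_sets (k - 1). \<Sum>y\<in>U X. 1 / real (card (U X)))"
  proof -
    have "(\<Sum>y\<in>U X. 1 / real (card (U X))) = 1" if "X \<in> split_sets (k - 1)" for X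
    proof -
      have X: "X \<in> \<I>" "E - X \<in> \<I>" "X \<subseteq> E" "card X = k - 1"
        using that by (auto simp: split_sets_def)
      then have "card (E - X) = k + 1"
        using cE k finite_ground by (simp add: card_Diff_subset indep_finite)
      \<comment> \<open>The independent complement has \<open>k + 1\<close> elements against
        \<open>k - 1\<close>, so some extension exists and the charge is well defined.\<close>
      then have "card X < card (E - X)" using X(4) by simp
      then have "U X \<noteq> {}" using indep_augment[OF X(1,2)] by (auto simp: U_def)
      then show ?thesis using finU by simp
    qed
    then show ?thesis by simp
  qed
  also have "\<dots> = (\<Sum>(X, y)\<in>Sigma (split_sets (k - 1)) U. 1 / real (card (U X)))"
    using finU finite_split_sets by (intro sum.Sigma) auto
  also have "\<dots> = (\<Sum>(C, c)\<in>(SIGMA C:split_sets k. ext C (E - C)).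
      1 / (1 + real (card (nbrs C (E - C) c))))"
  proof (rule sum.reindex_bij_witness[where
        j = "\<lambda>(X, y). (insert y X, y)" and i = "\<lambda>(C, c). (C - {c}, c)"])
    fix a assume "a \<in> Sigma (split_sets (k - 1)) U"
    then obtain X y where a: "a = (X, y)" and X: "X \<in> \<I>" "E - X \<in> \<I>" "X \<subseteq> E" "card X = k - 1"
      and y: "y \<in> E" "y \<notin> X" "insert y X \<in> \<I>"
      by (auto simp: split_sets_def U_def)
    have eq: "insert y (E - insert y X) = E - X" using y by auto
    have sub: "E - insert y X \<in> \<I>" by (rule indep_subset[OF X(2)]) blast
    show "(\<lambda>(C, c). (C - {c}, c)) ((\<lambda>(X, y). (insert y X, y)) a) = a" using a y by simp
    show "(\<lambda>(X, y). (insert y X, y)) a \<in> (SIGMA C:split_sets k. ext C (E - C))"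
      using a X y eq sub k by (simp add: split_sets_def ext_def indep_finite)
    have "U X = insert y (nbrs (insert y X) (E - insert y X) y)"
      using y by (auto simp: U_def nbrs_def)
    moreover have "y \<notin> nbrs (insert y X) (E - insert y X) y" by (simp add: nbrs_def)
    moreover have "finite (nbrs (insert y X) (E - insert y X) y)"
      using finite_ground by (simp add: nbrs_def)
    ultimately have "card (U X) = Suc (card (nbrs (insert y X) (E - insert y X) y))" by simp
    then show "(case (\<lambda>(X, y). (insert y X, y)) a of
        (C, c) \<Rightarrow> 1 / (1 + real (card (nbrs C (E - C) c)))) = (case a of (X, y) \<Rightarrow> 1 / real (card (U X)))"
      using a by simp
  next
    fix b assume "b \<in> (SIGMA C:split_sets k. ext C (E - C))"
    then obtain C c where b: "b = (C, c)" and C: "C \<in> \<I>" "E - C \<in> \<I>" "C \<subseteq> E" "card C = k"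
      and c: "c \<in> C" "insert c (E - C) \<in> \<I>"
      by (auto simp: split_sets_def ext_def)
    \<comment> \<open>Thus membership of \<open>c\<close> in \<open>ext C (E - C)\<close> says
      exactly that the complement of \<open>C - {c}\<close> is independent.\<close>
    have eq: "E - (C - {c}) = insert c (E - C)" using c C by auto
    have sub: "C - {c} \<in> \<I>" by (rule indep_subset[OF C(1)]) blast
    show "(\<lambda>(X, y). (insert y X, y)) ((\<lambda>(C, c). (C - {c}, c)) b) = b" using b c by auto
    show "(\<lambda>(C, c). (C - {c}, c)) b \<in> Sigma (split_sets (k - 1)) U"
      using b C c eq sub by (auto simp: split_sets_def U_def insert_absorb indep_finite)
  qed
  also have "\<dots> = (\<Sum>C\<in>split_sets k. load C (E - C))"
    unfolding load_def using finite_ground finite_split_sets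
    by (intro sum.Sigma[symmetric]) (auto simp: ext_def split_sets_def intro: finite_subset)
  finally show ?thesis .
qed

lemma card_split_sets_le:
  assumes cE: "card E = 2 * k" and k: "1 \<le> k" "k \<le> 5"
  shows "(real k + 1) * card (split_sets (k - 1)) \<le> k * card (split_sets k)"
proof -
  \<comment> \<open>Complementation is an involution of \<open>split_sets k\<close>, so twice the
    total load is a sum over complementary pairs.\<close>
  have compl: "(\<Sum>C\<in>split_sets k. load C (E - C)) = (\<Sum>C\<in>split_sets k. load (E - C) C)"
    using cE finite_ground
    by (intro sum.reindex_bij_witness[where i = "\<lambda>C. E - C" and j = "\<lambda>C. E - C"])
      (auto simp: split_sets_def double_diff card_Diff_subset finite_subset)
  have "2 * real (card (split_sets (k - 1))) = (\<Sum>C\<in>split_sets k. load C (E - C) + load (E - C) C)"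
    using card_split_sets_eq_load[OF cE k(1)] compl by (simp add: sum.distrib)
  also have "\<dots> \<le> (\<Sum>C\<in>split_sets k. 2 * real k / (real k + 1))"
  proof (rule sum_mono)
    fix C assume "C \<in> split_sets k"
    then have C: "C \<in> \<I>" "E - C \<in> \<I>" "C \<subseteq> E" "card C = k" by (auto simp: split_sets_def)
    then have "card (E - C) = k" using cE finite_ground by (simp add: card_Diff_subset indep_finite)
    then show "load C (E - C) + load (E - C) C \<le> 2 * real k / (real k + 1)"
      using C k by (intro load_sum_le) auto
  qed
  finally show ?thesis by (simp add: field_simps)
qed

section \<open>From counts to antipodal averages\<close>

lemma finite_indeps: "finite \<I>"
  using finite_ground indep_subset_ground by (auto intro: finite_subset[of _ "Pow E"])

lemma pmf_uniform_indep_eq_0: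
  assumes "X \<subseteq> E" "X \<notin> \<I>"
  shows "pmf (uniform_indep E \<I>) (indicator_vec E X) = 0"
proof -
  have "indicator_vec E X \<noteq> indicator_vec E A" if "A \<in> \<I>" for A
  proof
    assume eq: "indicator_vec E X = indicator_vec E A"
    have "i \<in> X \<longleftrightarrow> i \<in> A" if "i \<in> E" for i
      using fun_cong[OF eq, of i] that by (simp add: indicator_vec_def of_bool_eq_iff)
    then have "X = A" using assms indep_subset_ground[OF that] by blast
    then show False using that assms by simp
  qed
  moreover have "set_pmf (pmf_of_set \<I>) = \<I>"
    using indep_empty finite_indeps by (intro set_pmf_of_set) auto
  ultimately show ?thesis
    by (auto simp: uniform_indep_def pmf_eq_0_set_pmf)
qed

text \<open>Vectors correspond to their supports. A product of antipodal masses is nonzero exactly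
  when the support and its complement are both independent, and then each factor is
  \<open>1 / card \<I>\<close>.\<close>

lemma antipodal_avg_uniform_indep:
  "antipodal_avg E (uniform_indep E \<I>) i
     = inverse (real (card E choose i)) * (card (split_sets i) / (real (card \<I>))\<^sup>2)"
proof -
  let ?\<nu> = "uniform_indep E \<I>"
  have "(\<Sum>\<eta> | \<eta> \<in> cube E \<and> (\<Sum>j\<in>E. \<eta> j) = i. pmf ?\<nu> \<eta> * pmf ?\<nu> (\<lambda>j\<in>E. 1 - \<eta> j))
      = (\<Sum>X | X \<subseteq> E \<and> card X = i. pmf ?\<nu> (indicator_vec E X) * pmf ?\<nu> (indicator_vec E (E - X)))"
  proof (rule sum.reindex_bij_witness[where
        j = "\<lambda>\<eta>. {j \<in> E. \<eta> j = 1}" and i = "indicator_vec E"])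
    fix \<eta> :: "'a \<Rightarrow> nat" assume "\<eta> \<in> {\<eta>. \<eta> \<in> cube E \<and> (\<Sum>j\<in>E. \<eta> j) = i}"
    then have \<eta>: "\<eta> \<in> E \<rightarrow>\<^sub>E {0, 1}" "(\<Sum>j\<in>E. \<eta> j) = i" by (auto simp: cube_def)
    have val: "\<eta> j = 0 \<or> \<eta> j = 1" if "j \<in> E" for j
      using \<eta>(1) that by (auto simp: PiE_iff)
    show eq: "indicator_vec E {j \<in> E. \<eta> j = 1} = \<eta>"
    proof
      fix j show "indicator_vec E {j \<in> E. \<eta> j = 1} j = \<eta> j"
        using val[of j] PiE_arb[OF \<eta>(1), of j] by (cases "j \<in> E") (auto simp: indicator_vec_def)
    qed
    have "(\<Sum>j\<in>E. \<eta> j) = (\<Sum>j\<in>E. of_bool (\<eta> j = 1))" using val by (intro sum.cong) force+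
    also have "\<dots> = card {j \<in> E. \<eta> j = 1}"
      using finite_ground by (simp add: Int_def)
    finally show "{j \<in> E. \<eta> j = 1} \<in> {X. X \<subseteq> E \<and> card X = i}" using \<eta> by auto
    have "indicator_vec E (E - {j \<in> E. \<eta> j = 1}) = (\<lambda>j\<in>E. 1 - \<eta> j)"
    proof
      fix j show "indicator_vec E (E - {j \<in> E. \<eta> j = 1}) j = (\<lambda>j\<in>E. 1 - \<eta> j) j"
        using val[of j] by (cases "j \<in> E") (auto simp: indicator_vec_def)
    qed
    then show "pmf ?\<nu> (indicator_vec E {j \<in> E. \<eta> j = 1}) *
        pmf ?\<nu> (indicator_vec E (E - {j \<in> E. \<eta> j = 1})) = pmf ?\<nu> \<eta> * pmf ?\<nu> (\<lambda>j\<in>E. 1 - \<eta> j)"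
      using eq by simp
  next
    fix X assume "X \<in> {X. X \<subseteq> E \<and> card X = i}"
    then have X: "X \<subseteq> E" "card X = i" by auto
    show "{j \<in> E. indicator_vec E X j = 1} = X" using X by (auto simp: indicator_vec_def)
    have "(\<Sum>j\<in>E. indicator_vec E X j) = card X"
      using finite_ground X by (simp add: indicator_vec_def Int_absorb1)
    then show "indicator_vec E X \<in> {\<eta>. \<eta> \<in> cube E \<and> (\<Sum>j\<in>E. \<eta> j) = i}"
      using X by (auto simp: cube_def indicator_vec_def)
  qed
  also have "\<dots> = (\<Sum>X | X \<subseteq> E \<and> card X = i. if X \<in> split_sets i then 1 / (real (card \<I>))\<^sup>2 else 0)"
  proof (rule sum.cong[OF refl])
    fix X assume "X \<in> {X. X \<subseteq> E \<and> card X = i}"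
    then show "pmf ?\<nu> (indicator_vec E X) * pmf ?\<nu> (indicator_vec E (E - X))
        = (if X \<in> split_sets i then 1 / (real (card \<I>))\<^sup>2 else 0)"
      using pmf_uniform_indep[of X] pmf_uniform_indep[of "E - X"]
        pmf_uniform_indep_eq_0[of X] pmf_uniform_indep_eq_0[of "E - X"]
      by (auto simp: split_sets_def power2_eq_square)
  qed
  also have "\<dots> = card (split_sets i) / (real (card \<I>))\<^sup>2"
  proof -
    have "{X. X \<subseteq> E \<and> card X = i} \<inter> split_sets i = split_sets i"
      by (auto simp: split_sets_def)
    moreover have "finite {X. X \<subseteq> E \<and> card X = i}" using finite_ground by simp
    ultimately show ?thesis by (simp add: sum.If_cases)
  qed
  finally show ?thesis by (simp add: antipodal_avg_def)
qed

lemma APP_uniform_indep: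
  assumes cE: "card E = 2 * k" and k: "1 \<le> k" "k \<le> 5"
  shows "APP E (uniform_indep E \<I>)"
proof -
  define a b where "a = real (card (split_sets (k - 1)))" and "b = real (card (split_sets k))"
  define P Q where "P = real (2 * k choose (k - 1))" and "Q = real (2 * k choose k)"
  have pos: "P > 0" "Q > 0" using k by (auto simp: P_def Q_def)
  \<comment> \<open>This binomial ratio matches the factors \<open>k\<close> and
    \<open>k + 1\<close> of \<open>card_split_sets_le\<close>.\<close>
  have "k * (2 * k choose k) = (k + 1) * (2 * k choose (k - 1))"
    using k binomial_absorb_comp[of "2 * k" "k - 1"] binomial_absorption[of "k - 1" "2 * k"]
    by simp
  then have PQ: "k * Q = (real k + 1) * P"
    unfolding P_def Q_def by (metis of_nat_1 of_nat_add of_nat_mult)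
  have le: "(real k + 1) * a \<le> k * b"
    using card_split_sets_le[OF cE k] by (simp add: a_def b_def)
  have "k * (Q * a) = (k * Q) * a" by simp
  also have "\<dots> = P * ((real k + 1) * a)" unfolding PQ by simp
  also have "\<dots> \<le> P * (k * b)" using le pos by (intro mult_left_mono) auto
  finally have "Q * a \<le> P * b" using k by (simp add: algebra_simps)
  then have "inverse P * a \<le> inverse Q * b" using pos by (simp add: field_simps)
  then have "inverse P * a / (real (card \<I>))\<^sup>2 \<le> inverse Q * b / (real (card \<I>))\<^sup>2"
    by (intro divide_right_mono) auto
  then show ?thesis
    using cE k by (auto simp: APP_def antipodal_avg_uniform_indep a_def b_def P_def Q_def)
qed

section \<open>Minors and conditioning\<close>

definition minor :: "'a set \<Rightarrow> 'a set \<Rightarrow> 'a set set" where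
  "minor I J = {A. A \<subseteq> E - I \<and> A \<union> J \<in> \<I>}"

text \<open>This is the contraction of \<open>J\<close> and deletion of \<open>I - J\<close>.
  Augmentation carries over because \<open>J\<close> is disjoint from every member, so adjoining it
  preserves comparisons of size.\<close>

lemma matroid_minor:
  assumes "J \<subseteq> I" "J \<in> \<I>"
  shows "matroid (E - I) (minor I J)"
proof
  show "finite (E - I)" using finite_ground by simp
  show "{} \<in> minor I J" using assms by (simp add: minor_def)
next
  fix X assume "X \<in> minor I J"
  then show "X \<subseteq> E - I" by (simp add: minor_def)
next
  fix X Y assume "X \<in> minor I J" "Y \<subseteq> X"
  then show "Y \<in> minor I J" unfolding minor_def
    by (auto intro: indep_subset[of "X \<union> J"])
next
  fix X Y assume XY: "X \<in> minor I J" "Y \<in> minor I J" "card X < card Y"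
  then have ind: "X \<union> J \<in> \<I>" "Y \<union> J \<in> \<I>" and sub: "X \<subseteq> E - I" "Y \<subseteq> E - I"
    by (auto simp: minor_def)
  have "X \<inter> J = {}" "Y \<inter> J = {}" using sub assms by auto
  then have "card (X \<union> J) < card (Y \<union> J)"
    using XY(3) indep_finite[OF ind(1)] indep_finite[OF ind(2)] by (simp add: card_Un_disjoint)
  then obtain y where "y \<in> Y \<union> J - (X \<union> J)" "insert y (X \<union> J) \<in> \<I>"
    using indep_augment[OF ind] by blast
  then show "\<exists>y\<in>Y - X. insert y X \<in> minor I J"
    using sub by (auto simp: minor_def)
qed

text \<open>The event selects the independent \<open>X\<close> with \<open>X \<inter> I = J\<close>.
  On these \<open>X \<mapsto> X - I\<close> is injective with image \<open>minor I J\<close>, so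
  uniformity survives. Positive probability supplies such an \<open>X\<close>, whence
  \<open>J\<close> is independent.\<close>

lemma conditioned_uniform_indep:
  assumes I: "I \<subseteq> E" and \<xi>: "\<xi> \<in> cube I"
    and pos: "measure_pmf.prob (uniform_indep E \<I>) (agree_on I \<xi>) > 0"
  defines "J \<equiv> {i \<in> I. \<xi> i = 1}"
  shows "J \<in> \<I>" "conditioned E I \<xi> (uniform_indep E \<I>) = uniform_indep (E - I) (minor I J)"
proof -
  define B where "B = {X. X \<inter> I = J}"
  have agree: "indicator_vec E X \<in> agree_on I \<xi> \<longleftrightarrow> X \<in> B" for X
  proof -
    have "indicator_vec E X \<in> agree_on I \<xi> \<longleftrightarrow> (\<forall>i\<in>I. of_bool (i \<in> X) = \<xi> i)"
      using I by (auto simp: agree_on_def indicator_vec_def subset_iff)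
    also have "\<dots> \<longleftrightarrow> (\<forall>i\<in>I. i \<in> X \<longleftrightarrow> \<xi> i = 1)"
      using \<xi> by (intro ball_cong refl) (auto simp: cube_def PiE_iff)
    also have "\<dots> \<longleftrightarrow> X \<in> B" by (auto simp: B_def J_def)
    finally show ?thesis .
  qed
  have ne: "\<I> \<noteq> {}" using indep_empty by auto
  have supp: "set_pmf (pmf_of_set \<I>) = \<I>" by (rule set_pmf_of_set[OF ne finite_indeps])
  have "set_pmf (uniform_indep E \<I>) \<inter> agree_on I \<xi> \<noteq> {}"
    using pos by (metis Int_commute less_irrefl measure_Int_set_pmf measure_empty)
  then obtain X where X: "X \<in> \<I>" "X \<in> B"
    using supp agree by (auto simp: uniform_indep_def)
  then show "J \<in> \<I>" using indep_subset[of X J] by (auto simp: B_def)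
  have inter: "\<I> \<inter> B \<noteq> {}" using X by auto
  have vimage: "indicator_vec E -` agree_on I \<xi> = B" using agree by auto
  have "cond_pmf (uniform_indep E \<I>) (agree_on I \<xi>) = map_pmf (indicator_vec E) (pmf_of_set (\<I> \<inter> B))"
    unfolding uniform_indep_def
    by (subst cond_map_pmf) (use supp vimage inter cond_pmf_of_set[OF finite_indeps, of B] in auto)
  then have "conditioned E I \<xi> (uniform_indep E \<I>)
      = map_pmf (\<lambda>X. restrict (indicator_vec E X) (E - I)) (pmf_of_set (\<I> \<inter> B))"
    by (simp add: conditioned_def pmf.map_comp o_def)
  also have "(\<lambda>X. restrict (indicator_vec E X) (E - I)) = (\<lambda>X. indicator_vec (E - I) (X - I))"
    by (auto simp: fun_eq_iff indicator_vec_def)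
  also have "map_pmf (\<lambda>X. indicator_vec (E - I) (X - I)) (pmf_of_set (\<I> \<inter> B))
      = map_pmf (indicator_vec (E - I)) (map_pmf (\<lambda>X. X - I) (pmf_of_set (\<I> \<inter> B)))"
    by (simp add: pmf.map_comp o_def)
  also have "map_pmf (\<lambda>X. X - I) (pmf_of_set (\<I> \<inter> B)) = pmf_of_set ((\<lambda>X. X - I) ` (\<I> \<inter> B))"
    using inter finite_indeps
    by (intro map_pmf_of_set_inj inj_onI) (auto simp: B_def)
  also have "(\<lambda>X. X - I) ` (\<I> \<inter> B) = minor I J"
  proof
    show "(\<lambda>X. X - I) ` (\<I> \<inter> B) \<subseteq> minor I J"
    proof clarify
      fix X assume "X \<in> \<I>" "X \<in> B"
      moreover from this have "X - I \<union> J = X" by (auto simp: B_def)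
      ultimately show "X - I \<in> minor I J"
        using indep_subset_ground by (auto simp: minor_def)
    qed
    show "minor I J \<subseteq> (\<lambda>X. X - I) ` (\<I> \<inter> B)"
    proof
      fix A assume "A \<in> minor I J"
      then show "A \<in> (\<lambda>X. X - I) ` (\<I> \<inter> B)"
        by (intro image_eqI[of _ _ "A \<union> J"]) (auto simp: minor_def B_def J_def)
    qed
  qed
  finally show "conditioned E I \<xi> (uniform_indep E \<I>) = uniform_indep (E - I) (minor I J)"
    by (simp add: uniform_indep_def)
qed

end

theorem theorem1p7:
  fixes E :: "'a set" and \<I> :: "'a set set"
  assumes "matroid E \<I>" and "card E \<le> 11"
  shows "CAPP E (uniform_indep E \<I>)"
  unfolding CAPP_def
proof (intro allI impI, elim conjE)
  interpret matroid E \<I> by (rule assms)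
  fix k :: nat and I and \<xi> :: "'a \<Rightarrow> nat"
  assume k: "1 \<le> k" and I: "I \<subseteq> E" "card I + 2 * k = card E" and \<xi>: "\<xi> \<in> cube I"
    and pos: "measure_pmf.prob (uniform_indep E \<I>) (agree_on I \<xi>) > 0"
  define J where "J = {i \<in> I. \<xi> i = 1}"
  note cond = conditioned_uniform_indep[OF I(1) \<xi> pos, folded J_def]
  interpret M: matroid "E - I" "minor I J"
    using cond(1) by (intro matroid_minor) (auto simp: J_def)
  have "card (E - I) = 2 * k"
    using I finite_ground by (simp add: card_Diff_subset finite_subset)
  \<comment> \<open>An even number of coordinates remains, so a ground set of 11 elements still
    gives \<open>2 * k \<le> 10\<close>.\<close>
  moreover have "k \<le> 5" using I assms(2) by linarith
  ultimately show "APP (E - I) (conditioned E I \<xi> (uniform_indep E \<I>))"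
    using M.APP_uniform_indep k cond(2) by simp
qed

end
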